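(* Let $p_1,\dots,p_m$ be independent $p$-values with set of true nulls $\mathcal H_0\subset\{1,\dots,m\}$, such that $p_i\sim U(0,1)$ for all $i\in\mathcal H_0$. Let $\delta\in(0,1)$, $\kappa=\pi^2/6$, and for $k=1,\dots,m$ let $$R_k=\{1\le i\le m: p_i\le p_{(k)}\},\qquad \overline{\mathrm{FDP}}_k^{\mathrm{Well}}=1\wedge\left(\frac{m\,p_{(k)}}{k}\,h^{-1}\!\left(\frac{2\log(\kappa/\delta)+4\log\bigl(1+\log_2(1/p_{(k)})\bigr)}{m\,p_{(k)}}\right)\right).$$ Then $$\mathbf P\bigl(\forall k\in\{1,\dots,m\},\ \mathrm{FDP}(R_k)\le\overline{\mathrm{FDP}}_k^{\mathrm{Well}}\bigr)\ge 1-\delta .$$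
   Context: Top-$k$ setting: $p_1,\dots,p_m$ take values in $[0,1]$ and are independent; $\mathcal H_0$ is a fixed subset of $\{1,\dots,m\}$ with cardinality $m_0$, $0<m_0<m$; nothing is assumed on the marginal distributions of $p_i$, $i\notin\mathcal H_0$. $p_{(1)}\le\dots\le p_{(m)}$ are the ordered $p$-values. For $R\subset\{1,\dots,m\}$, $\mathrm{FDP}(R)=|R\cap\mathcal H_0|/(|R|\vee1)$. The function $h(\lambda)=\lambda(\log\lambda-1)+1$, $\lambda>1$, is an increasing bijection from $(1,\infty)$ onto $(0,\infty)$, with inverse $h^{-1}:(0,\infty)\to(1,\infty)$. If $p_{(k)}=0$, the quantity $\overline{\mathrm{FDP}}_k^{\mathrm{Well}}$ is read as its limit $0$. *)

theory Defs
  imports "HOL-Probability.Probability"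
begin

definition h_fun :: "real \<Rightarrow> real" where
  "h_fun l = l * (ln l - 1) + 1"

text \<open>Only meaningful on the positive reals; see \<open>bij_betw_h_fun\<close> below.\<close>
definition h_inv :: "real \<Rightarrow> real" where
  "h_inv = the_inv_into {1<..} h_fun"

lemma h_fun_deriv: "x > 0 \<Longrightarrow> (h_fun has_real_derivative ln x) (at x)"
  unfolding h_fun_def[abs_def] by (auto intro!: derivative_eq_intros)

lemma h_fun_strict_mono:
  assumes "1 \<le> x" "x < y"
  shows "h_fun x < h_fun y"
proof (rule DERIV_pos_imp_increasing_open[OF assms(2)])
  fix z assume "x < z" "z < y"
  then show "\<exists>d. (h_fun has_real_derivative d) (at z) \<and> 0 < d"
    using assms by (intro exI[of _ "ln z"]) (auto intro: h_fun_deriv)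
next
  show "continuous_on {x..y} h_fun"
    unfolding h_fun_def[abs_def] using assms by (auto intro!: continuous_intros)
qed

lemma bij_betw_h_fun: "bij_betw h_fun {1<..} {0<..}"
proof (rule bij_betw_imageI)
  show "inj_on h_fun {1<..}"
  proof (rule inj_onI, rule ccontr)
    fix x y :: real
    assume xy: "x \<in> {1<..}" "y \<in> {1<..}" "h_fun x = h_fun y" "x \<noteq> y"
    then consider "x < y" | "y < x" by linarith
    then show False
      using xy h_fun_strict_mono[of x y] h_fun_strict_mono[of y x] by cases simp_all
  qed
  have h1: "h_fun 1 = 0" by (simp add: h_fun_def)
  show "h_fun ` {1<..} = {0<..}"
  proof (intro equalityI subsetI)
    fix y assume "y \<in> h_fun ` {1<..}"
    then show "y \<in> {0<..}" using h_fun_strict_mono[of 1] h1 by auto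
  next
    fix y :: real assume y: "y \<in> {0<..}"
    define b where "b = exp 2 + y"
    have b: "1 \<le> b" "exp 2 \<le> b" "y \<le> b"
      using y exp_ge_add_one_self[of 2] by (auto simp: b_def)
    have "2 \<le> ln b" using b by (subst ln_ge_iff) auto
    then have "b * 1 \<le> b * (ln b - 1)" using b by (intro mult_left_mono) auto
    then have hb: "y \<le> h_fun b" using b(3) unfolding h_fun_def by linarith
    have "continuous_on {1..b} h_fun"
      unfolding h_fun_def[abs_def] by (auto intro!: continuous_intros)
    then obtain x where x: "1 \<le> x" "x \<le> b" "h_fun x = y"
      using IVT'[of h_fun 1 y b] h1 y b hb by auto
    have "x \<noteq> 1" using x h1 y by auto
    then show "y \<in> h_fun ` {1<..}" using x by force
  qed
qed

text \<open>Realized p-values are functions \<open>x\<close> on the index set \<open>{1..m}\<close>.\<close>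
definition order_stat :: "nat \<Rightarrow> (nat \<Rightarrow> real) \<Rightarrow> nat \<Rightarrow> real" where
  "order_stat m x k = sort (map x [1..<Suc m]) ! (k - 1)"

definition FDP :: "nat set \<Rightarrow> nat set \<Rightarrow> real" where
  "FDP H0 R = real (card (R \<inter> H0)) / real (max (card R) 1)"

definition top_k :: "nat \<Rightarrow> (nat \<Rightarrow> real) \<Rightarrow> nat \<Rightarrow> nat set" where
  "top_k m x k = {i \<in> {1..m}. x i \<le> order_stat m x k}"

definition FDP_Well :: "real \<Rightarrow> nat \<Rightarrow> (nat \<Rightarrow> real) \<Rightarrow> nat \<Rightarrow> real" where
  "FDP_Well \<delta> m x k =
    (let q = order_stat m x k; \<kappa> = pi\<^sup>2 / 6 in
     if q = 0 then 0
     else min 1 (real m * q / real k *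
            h_inv ((2 * ln (\<kappa> / \<delta>) + 4 * ln (1 + log 2 (1 / q))) / (real m * q))))"

end

theory Submission
  imports Defs
begin

text \<open>
  Let \<open>N t\<close> be the number of null \<open>p\<close>-values below \<open>t\<close>. If \<open>N t \<ge> c * t\<close> for some \<open>t \<ge> a\<close>, then
  also \<open>N (k / c) \<ge> k\<close> for the integer \<open>k = N t\<close>, and for the largest such \<open>k\<close> equality holds. Given
  the set \<open>S\<close> of the \<open>k\<close> nulls below \<open>k / c\<close> and the values of the others, the members of \<open>S\<close> are
  independent and uniform on \<open>[0, k / c]\<close>, so \<open>N a\<close> has conditional mean \<open>c * a\<close>, and Jensen's
  inequality bounds the probability of a crossing by \<open>exp (- r * c * a)\<close> times the moment generating
  function of \<open>N a\<close> at \<open>r\<close>. With \<open>c = m * l\<close> and \<open>r = ln l\<close> this is Wellner's bound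
  \<open>exp (- m * a * h l)\<close>. It is applied at \<open>a = 1/2, 1/4, 1/8, \<dots>\<close>, with \<open>l\<close> chosen to give the
  \<open>j\<close>-th event probability at most \<open>\<delta> / (\<kappa> * j\<^sup>2)\<close>; these bounds sum to \<open>\<delta>\<close>.
\<close>

section \<open>Order statistics in terms of counts\<close>

text \<open>In a sorted list the positions of the entries \<open>\<le> t\<close> form an initial
  segment. Positions start at 0, so lying in this segment is a strict comparison with its
  length.\<close>

lemma sorted_nth_le_iff:
  fixes xs :: "'a::linorder list"
  assumes "sorted xs" "i < length xs"
  shows "xs ! i \<le> t \<longleftrightarrow> i < length (filter (\<lambda>x. x \<le> t) xs)"
proof -
  let ?A = "{j. j < length xs \<and> xs ! j \<le> t}"
  show ?thesis
  proof
    assume "xs ! i \<le> t"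
    then have "{..i} \<subseteq> ?A"
      using assms by (auto intro: order.trans[OF sorted_nth_mono])
    then have "card {..i} \<le> card ?A" by (intro card_mono) auto
    then show "i < length (filter (\<lambda>x. x \<le> t) xs)" by (simp add: length_filter_conv_card)
  next
    assume *: "i < length (filter (\<lambda>x. x \<le> t) xs)"
    show "xs ! i \<le> t"
    proof (rule ccontr)
      assume "\<not> xs ! i \<le> t"
      then have "j < i" if "j \<in> ?A" for j
        using that assms sorted_nth_mono[of xs i j] by (cases "j < i") force+
      then have "card ?A \<le> card {..<i}" by (intro card_mono) auto
      then show False using * by (simp add: length_filter_conv_card)
    qed
  qed
qed

text \<open>This trades the sorted list for a count, the form in which both measurability and the
  size of \<open>top_k\<close> are accessible.\<close>

lemma order_stat_le_iff:
  assumes "k \<in> {1..m}"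
  shows "order_stat m x k \<le> t \<longleftrightarrow> k \<le> card {i \<in> {1..m}. x i \<le> t}"
proof -
  have "length (filter (\<lambda>y. y \<le> t) (sort (map x [1..<Suc m])))
      = length (filter (\<lambda>y. y \<le> t) (map x [1..<Suc m]))"
    by (metis mset_filter mset_sort size_mset)
  also have "\<dots> = length (filter (\<lambda>i. x i \<le> t) [1..<Suc m])"
    by (simp add: filter_map o_def del: upt_Suc)
  also have "\<dots> = card {i \<in> {1..m}. x i \<le> t}"
    by (subst distinct_length_filter) (auto intro!: arg_cong[where f=card])
  finally show ?thesis
    using assms unfolding order_stat_def
    by (subst sorted_nth_le_iff) (auto simp del: upt_Suc)
qed

lemma order_stat_mem:
  assumes "k \<in> {1..m}"
  shows "order_stat m x k \<in> x ` {1..m}"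
proof -
  have "order_stat m x k \<in> set (sort (map x [1..<Suc m]))"
    using assms unfolding order_stat_def by (intro nth_mem) (auto simp del: upt_Suc)
  then show ?thesis by (auto simp del: upt_Suc)
qed

section \<open>The inverse of \<open>h_fun\<close> and elementary tools\<close>

lemma h_inv_gt_1: "0 < y \<Longrightarrow> 1 < h_inv y"
  and h_fun_h_inv: "0 < y \<Longrightarrow> h_fun (h_inv y) = y"
  using the_inv_into_into[OF bij_betw_imp_inj_on[OF bij_betw_h_fun], of y "{1<..}"]
    f_the_inv_into_f_bij_betw[OF bij_betw_h_fun, of y]
    bij_betw_imp_surj_on[OF bij_betw_h_fun]
  by (auto simp: h_inv_def)

lemma h_inv_mono:
  assumes "0 < x" "x \<le> y"
  shows "h_inv x \<le> h_inv y"
proof (rule ccontr)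
  assume "\<not> h_inv x \<le> h_inv y"
  then have "h_fun (h_inv y) < h_fun (h_inv x)"
    using h_inv_gt_1[of y] assms by (intro h_fun_strict_mono) auto
  then show False using assms by (simp add: h_fun_h_inv)
qed

text \<open>Off the positive reals nothing is known about \<open>h_inv\<close>. The value 1 lies
  below all its values on the positive reals, so the modified function is monotone on the whole line
  and hence Borel.\<close>

lemma borel_measurable_h_inv_pos:
  "(\<lambda>y. if 0 < y then h_inv y else 1) \<in> borel_measurable borel"
  by (intro borel_measurable_mono monoI)
     (auto intro: h_inv_mono less_imp_le[OF h_inv_gt_1])

text \<open>Convexity of \<open>exp\<close> between 0 and \<open>r\<close>. This is Jensen's
  inequality for a Bernoulli variable with mean \<open>u\<close>, whose moment generating function
  at \<open>r\<close> is the right-hand side.\<close>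

lemma exp_mult_le_chord:
  fixes u r :: real
  assumes "0 \<le> u" "u \<le> 1"
  shows "exp (u * r) \<le> 1 + u * (exp r - 1)"
  using convex_onD[OF exp_convex, of u 0 r] assms by (simp add: algebra_simps)

lemma measurable_card_le:
  fixes p :: "nat \<Rightarrow> 'a \<Rightarrow> real"
  assumes p: "\<And>i. i \<in> A \<Longrightarrow> p i \<in> borel_measurable M" and q: "q \<in> borel_measurable M"
  shows "(\<lambda>\<omega>. card {i \<in> A. p i \<omega> \<le> q \<omega>}) \<in> measurable M (count_space UNIV)"
proof (rule measurable_card)
  show "{\<omega> \<in> space M. i \<in> {i \<in> A. p i \<omega> \<le> q \<omega>}} \<in> sets M" for i
  proof (cases "i \<in> A")
    case True
    have "{\<omega> \<in> space M. p i \<omega> \<le> q \<omega>} \<in> sets M"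
      by (rule borel_measurable_le[OF p[OF True] q])
    then show ?thesis using True by simp
  qed simp
qed

section \<open>Exponential bound for crossings of a line by the empirical process\<close>

context prob_space
begin

text \<open>This plays the role of conditioning on the coordinates outside \<open>S\<close>: those
  inside \<open>S\<close> factor one by one, while the others may enter through any bounded
  measurable \<open>g\<close>. The bounds \<open>B\<close> and \<open>C\<close> supply
  integrability.\<close>

lemma indep_vars_expectation_prod_times:
  fixes X :: "'i \<Rightarrow> 'a \<Rightarrow> 'b" and f :: "'i \<Rightarrow> 'b \<Rightarrow> real" and g :: "('i \<Rightarrow> 'b) \<Rightarrow> real"
  assumes indep: "indep_vars N X I" and fin: "finite I" and "S \<subseteq> I"
    and f [measurable]: "\<And>i. i \<in> S \<Longrightarrow> f i \<in> borel_measurable (N i)"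
    and fB: "\<And>i x. i \<in> S \<Longrightarrow> \<bar>f i x\<bar> \<le> B"
    and g [measurable]: "g \<in> borel_measurable (PiM (I - S) N)" and gB: "\<And>x. \<bar>g x\<bar> \<le> C"
  shows "expectation (\<lambda>\<omega>. (\<Prod>i\<in>S. f i (X i \<omega>)) * g (restrict (\<lambda>i. X i \<omega>) (I - S)))
       = (\<Prod>i\<in>S. expectation (\<lambda>\<omega>. f i (X i \<omega>))) * expectation (\<lambda>\<omega>. g (restrict (\<lambda>i. X i \<omega>) (I - S)))"
proof -
  have finS: "finite S" using fin \<open>S \<subseteq> I\<close> by (rule finite_subset[rotated])
  have X [measurable]: "random_variable (N i) (X i)" if "i \<in> I" for i
    using indep that by (auto simp: indep_vars_def)
  have fX [measurable]: "(\<lambda>\<omega>. f i (X i \<omega>)) \<in> borel_measurable M" if "i \<in> S" for i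
    by (rule measurable_compose[OF X f]) (use that \<open>S \<subseteq> I\<close> in auto)
  have restr [measurable]: "random_variable (PiM A N) (\<lambda>\<omega>. restrict (\<lambda>i. X i \<omega>) A)" if "A \<subseteq> I" for A
    using that by (intro measurable_restrict) auto
  \<comment> \<open>The product must be a function of the restricted family for
    \<open>indep_var_restrict\<close> to apply.\<close>
  have prod_restr: "(\<Prod>i\<in>S. f i (X i \<omega>)) = (\<Prod>i\<in>S. f i (restrict (\<lambda>i. X i \<omega>) S i))" for \<omega>
    by (intro prod.cong) auto
  have "indep_var borel ((\<lambda>x. \<Prod>i\<in>S. f i (x i)) \<circ> (\<lambda>\<omega>. restrict (\<lambda>i. X i \<omega>) S))
                  borel (g \<circ> (\<lambda>\<omega>. restrict (\<lambda>i. X i \<omega>) (I - S)))"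
    by (rule indep_var_compose[OF indep_var_restrict[OF indep]]) (use \<open>S \<subseteq> I\<close> in \<open>auto\<close>)
  then have ind: "indep_var borel (\<lambda>\<omega>. \<Prod>i\<in>S. f i (X i \<omega>))
                  borel (\<lambda>\<omega>. g (restrict (\<lambda>i. X i \<omega>) (I - S)))"
    unfolding o_def prod_restr[symmetric] .
  have "integrable M (\<lambda>\<omega>. \<Prod>i\<in>S. f i (X i \<omega>))"
  proof (rule integrable_const_bound[where B="\<Prod>i\<in>S. B"])
    show "AE \<omega> in M. norm (\<Prod>i\<in>S. f i (X i \<omega>)) \<le> (\<Prod>i\<in>S. B)"
      unfolding real_norm_def abs_prod by (intro AE_I2 prod_mono) (auto simp: fB)
  qed measurable
  moreover have "integrable M (\<lambda>\<omega>. g (restrict (\<lambda>i. X i \<omega>) (I - S)))"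
    by (rule integrable_const_bound[where B=C])
       (auto simp: gB intro!: measurable_compose[OF restr g])
  ultimately have "expectation (\<lambda>\<omega>. (\<Prod>i\<in>S. f i (X i \<omega>)) * g (restrict (\<lambda>i. X i \<omega>) (I - S)))
      = expectation (\<lambda>\<omega>. \<Prod>i\<in>S. f i (X i \<omega>)) * expectation (\<lambda>\<omega>. g (restrict (\<lambda>i. X i \<omega>) (I - S)))"
    by (rule indep_var_lebesgue_integral[OF ind])
  also have "expectation (\<lambda>\<omega>. \<Prod>i\<in>S. f i (X i \<omega>)) = (\<Prod>i\<in>S. expectation (\<lambda>\<omega>. f i (X i \<omega>)))"
  proof (rule indep_vars_lebesgue_integral[OF finS])
    show "indep_vars (\<lambda>_. borel) (\<lambda>i \<omega>. f i (X i \<omega>)) S"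
      by (rule indep_vars_compose2[OF indep_vars_subset[OF indep \<open>S \<subseteq> I\<close>]]) (rule f)
    show "integrable M (\<lambda>\<omega>. f i (X i \<omega>))" if "i \<in> S" for i
      by (rule integrable_const_bound[where B=B]) (use that fB in auto)
  qed
  finally show ?thesis .
qed

lemma uniform_prob_le:
  assumes "random_variable borel X" "distr M borel X = uniform_measure lborel {0..1}" "0 \<le> t" "t \<le> (1::real)"
  shows "prob {\<omega> \<in> space M. X \<omega> \<le> t} = t"
proof -
  have "prob {\<omega> \<in> space M. X \<omega> \<le> t} = measure (distr M borel X) {..t}"
    using assms(1) by (subst measure_distr) (auto intro!: arg_cong[where f=prob])
  also have "\<dots> = measure lborel ({0..1} \<inter> {..t})"
    by (simp add: assms(2))
  also have "{0..1} \<inter> {..t} = {0..t}" using assms by auto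
  finally show ?thesis using assms by simp
qed

text \<open>The mean of one factor of the weight used below; with \<open>d = b - 1\<close> and
  \<open>{..a}\<close> inside \<open>A\<close>, the factor is \<open>b\<close> on
  \<open>{..a}\<close> and 1 on the rest of \<open>A\<close>.\<close>

lemma uniform_expectation_indicators:
  fixes a d :: real
  assumes X [measurable]: "random_variable borel X"
    and unif: "distr M borel X = uniform_measure lborel {0..1}" and a: "0 \<le> a" "a \<le> 1"
    and A [measurable]: "A \<in> sets borel"
  shows "expectation (\<lambda>\<omega>. indicator A (X \<omega>) + d * indicator {..a} (X \<omega>))
       = prob {\<omega> \<in> space M. X \<omega> \<in> A} + d * a"
proof -
  have 1: "expectation (\<lambda>\<omega>. indicator B (X \<omega>)) = prob {\<omega> \<in> space M. X \<omega> \<in> B}"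
    if [measurable]: "B \<in> sets borel" for B
  proof -
    have "expectation (\<lambda>\<omega>. indicator B (X \<omega>)) = expectation (indicator {\<omega> \<in> space M. X \<omega> \<in> B})"
      by (intro Bochner_Integration.integral_cong) (auto simp: indicator_def)
    also have "\<dots> = prob ({\<omega> \<in> space M. X \<omega> \<in> B} \<inter> space M)"
      by (rule Bochner_Integration.integral_indicator)
    also have "{\<omega> \<in> space M. X \<omega> \<in> B} \<inter> space M = {\<omega> \<in> space M. X \<omega> \<in> B}" by auto
    finally show ?thesis .
  qed
  have 2: "integrable M (\<lambda>\<omega>. indicator B (X \<omega>) :: real)" if [measurable]: "B \<in> sets borel" for B
    by (rule integrable_const_bound[where B=1]) (auto simp: indicator_def)
  show ?thesis
    using uniform_prob_le[OF X unif a] by (simp add: 1 2)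
qed

text \<open>Only thresholds \<open>k / c\<close> with integer \<open>k\<close> occur, so finitely
  many sets \<open>S\<close> describe the last crossing. For each of them the mean of
  \<open>exp (r * N a)\<close> over \<open>E S\<close> is at least \<open>exp (r * c * a)\<close>
  times the probability of \<open>E S\<close>; summing over the disjoint \<open>E S\<close> gives
  the bound.\<close>

lemma prob_empirical_crossing_le:
  fixes p :: "nat \<Rightarrow> 'a \<Rightarrow> real" and a c r :: real
  assumes indep: "indep_vars (\<lambda>_. borel) p H" and fin: "finite H"
    and unif: "\<And>i. i \<in> H \<Longrightarrow> distr M borel (p i) = uniform_measure lborel {0..1}"
    and a: "0 < a" "a \<le> 1" and r: "0 \<le> r" and c: "real (card H) < c"
  shows "prob {\<omega> \<in> space M. \<exists>k\<in>{..card H}. c * a \<le> k \<and> k \<le> card {i \<in> H. p i \<omega> \<le> real k / c}}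
       \<le> exp (card H * a * (exp r - 1) - r * c * a)"
proof -
  have c0: "0 < c" using c by linarith
  have p [measurable]: "random_variable borel (p i)" if "i \<in> H" for i
    using indep that by (auto simp: indep_vars_def)
  \<comment> \<open>\<open>E S\<close>: the last crossing is at \<open>card S / c\<close>, and \<open>S\<close> is the set of points below it.\<close>
  define E where "E S = {\<omega> \<in> space M. {i \<in> H. p i \<omega> \<le> card S / c} = S \<and>
    (\<forall>l\<in>{card S<..card H}. card {i \<in> H. p i \<omega> \<le> real l / c} < l)}" for S
  \<comment> \<open>\<open>W b\<close> is \<open>b\<close> raised to the number of points in
    \<open>{..a}\<close>, written as a product so that independence applies. The indicator of
    \<open>UNIV\<close> is the constant 1 in the shape of
    \<open>uniform_expectation_indicators\<close>.\<close>
  define W where "W b \<omega> = (\<Prod>i\<in>H. indicator UNIV (p i \<omega>) + (b - 1) * indicator {..a} (p i \<omega>))"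
    for b :: real and \<omega>
  define F where "F = {S \<in> Pow H. c * a \<le> card S}"
  have finF: "finite F" using fin by (auto simp: F_def)
  have [measurable]: "(\<lambda>\<omega>. card {i \<in> H. p i \<omega> \<le> t}) \<in> measurable M (count_space UNIV)" for t
    by (rule measurable_card_le) auto
  have E_eq: "E S = {\<omega> \<in> space M. (\<forall>i\<in>H. p i \<omega> \<le> card S / c \<longleftrightarrow> i \<in> S) \<and>
    (\<forall>l\<in>{card S<..card H}. card {i \<in> H. p i \<omega> \<le> real l / c} < l)}" if "S \<subseteq> H" for S
    unfolding E_def using that by (intro Collect_cong) blast
  have Em [measurable]: "E S \<in> sets M" if "S \<subseteq> H" for S
    unfolding E_eq[OF that] using fin by measurable
  have Wm [measurable]: "W b \<in> borel_measurable M" for b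
    unfolding W_def[abs_def] by measurable
  have Wint: "integrable M (W b)" if "1 \<le> b" for b
  proof (rule integrable_const_bound[where B="\<Prod>i\<in>H. b"])
    show "AE \<omega> in M. norm (W b \<omega>) \<le> (\<Prod>i\<in>H. b)"
      unfolding real_norm_def abs_prod W_def using that
      by (intro AE_I2 prod_mono) (auto simp: indicator_def)
  qed measurable
  have W_nonneg: "0 \<le> W b \<omega>" if "1 \<le> b" for b \<omega>
    unfolding W_def using that by (intro prod_nonneg) (auto simp: indicator_def)
  have EW: "expectation (W b) = (1 + (b - 1) * a) ^ card H" for b
  proof -
    have "expectation (W b)
        = expectation (\<lambda>\<omega>. (\<Prod>i\<in>H. indicator UNIV (p i \<omega>) + (b - 1) * indicator {..a} (p i \<omega>)) * 1)"
      by (simp add: W_def[abs_def])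
    also have "\<dots> = (\<Prod>i\<in>H. expectation (\<lambda>\<omega>. indicator UNIV (p i \<omega>) + (b - 1) * indicator {..a} (p i \<omega>)))
        * expectation (\<lambda>\<omega>. 1)"
      by (rule indep_vars_expectation_prod_times[OF indep fin order.refl, where B="1 + \<bar>b - 1\<bar>" and C=1])
         (auto simp: indicator_def)
    also have "\<dots> = (\<Prod>i\<in>H. 1 + (b - 1) * a) * 1"
      using a by (intro arg_cong2[where f="(*)"] prod.cong refl)
                 (subst uniform_expectation_indicators, auto simp: p unif prob_space)
    finally show ?thesis by simp
  qed
  \<comment> \<open>The point is that \<open>G\<close> does not depend on \<open>b\<close>: it is
    the probability of the condition on the points outside \<open>S\<close>, so \<open>b = 1\<close>
    and \<open>b = exp r\<close> can be compared.\<close>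
  have key: "\<exists>G\<ge>0. \<forall>b. expectation (\<lambda>\<omega>. W b \<omega> * indicator (E S) \<omega>)
      = (card S / c + (b - 1) * a) ^ card S * G" if S: "S \<in> F" for S
  proof -
    define t where "t = card S / c"
    have SH: "S \<subseteq> H" and cak: "c * a \<le> card S" using S by (auto simp: F_def)
    have finS: "finite S" using fin SH by (rule finite_subset[rotated])
    have at: "a \<le> t" using cak c0 by (simp add: t_def field_simps)
    have "card S \<le> card H" using SH fin by (rule card_mono[rotated])
    \<comment> \<open>The hypothesis \<open>card H < c\<close> keeps the threshold in the range
      where the uniform distribution function is the identity.\<close>
    then have t1: "t \<le> 1" using c c0 by (simp add: t_def field_simps)
    \<comment> \<open>Points of \<open>S\<close> lie below \<open>t\<close>, hence below every later
      threshold, and so contribute the constant \<open>card S\<close> to each count. What remains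
      concerns \<open>H - S\<close> only.\<close>
    define Q where "Q x \<longleftrightarrow> (\<forall>i\<in>H - S. t < x i) \<and>
      (\<forall>l\<in>{card S<..card H}. card S + card {i \<in> H - S. x i \<le> real l / c} < l)" for x :: "nat \<Rightarrow> real"
    define g :: "(nat \<Rightarrow> real) \<Rightarrow> real" where "g x = of_bool (Q x)" for x
    have [measurable]: "(\<lambda>x. card {i \<in> H - S. x i \<le> s})
        \<in> measurable (PiM (H - S) (\<lambda>_. borel)) (count_space UNIV)" for s :: real
      by (rule measurable_card_le) auto
    have gm: "g \<in> borel_measurable (PiM (H - S) (\<lambda>_. borel))"
      unfolding g_def Q_def using fin by measurable
    have gB: "\<bar>g x\<bar> \<le> 1" for x by (simp add: g_def)
    have restr_Q: "Q (restrict (\<lambda>i. p i \<omega>) (H - S)) \<longleftrightarrow> Q (\<lambda>i. p i \<omega>)" for \<omega>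
    proof -
      have "{i \<in> H - S. restrict (\<lambda>i. p i \<omega>) (H - S) i \<le> s} = {i \<in> H - S. p i \<omega> \<le> s}" for s
        by auto
      then show ?thesis by (simp add: Q_def)
    qed
    have E_iff: "\<omega> \<in> E S \<longleftrightarrow> (\<forall>i\<in>S. p i \<omega> \<le> t) \<and> Q (\<lambda>i. p i \<omega>)" if "\<omega> \<in> space M" for \<omega>
    proof -
      have 1: "card {i \<in> H. p i \<omega> \<le> real l / c} = card S + card {i \<in> H - S. p i \<omega> \<le> real l / c}"
        if "\<forall>i\<in>S. p i \<omega> \<le> t" "card S < l" for l
      proof -
        have "t \<le> real l / c" unfolding t_def using that c0 by (intro divide_right_mono) auto
        then have "{i \<in> H. p i \<omega> \<le> real l / c} = S \<union> {i \<in> H - S. p i \<omega> \<le> real l / c}"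
          using that SH by force
        then show ?thesis using finS fin by (subst card_Un_disjoint[symmetric]) auto
      qed
      have 2: "(\<forall>i\<in>H. p i \<omega> \<le> t \<longleftrightarrow> i \<in> S) \<longleftrightarrow> (\<forall>i\<in>S. p i \<omega> \<le> t) \<and> (\<forall>i\<in>H - S. t < p i \<omega>)"
        using SH by (auto simp: not_le[symmetric])
      show ?thesis
        unfolding E_eq[OF SH] Q_def t_def[symmetric] using that 1 2 by auto
    qed
    \<comment> \<open>On \<open>E S\<close> the points outside \<open>S\<close> exceed
      \<open>t \<ge> a\<close>, so their factors in \<open>W b\<close> are 1. Off \<open>E S\<close>
      either some factor over \<open>S\<close> vanishes or \<open>g\<close> does.\<close>
    have ident: "W b \<omega> * indicator (E S) \<omega>
        = (\<Prod>i\<in>S. indicator {..t} (p i \<omega>) + (b - 1) * indicator {..a} (p i \<omega>))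
          * g (restrict (\<lambda>i. p i \<omega>) (H - S))" if \<omega>: "\<omega> \<in> space M" for b \<omega>
    proof (cases "\<omega> \<in> E S")
      case True
      then have *: "\<forall>i\<in>S. p i \<omega> \<le> t" "\<forall>i\<in>H - S. t < p i \<omega>" "Q (\<lambda>i. p i \<omega>)"
        using E_iff[OF \<omega>] by (auto simp: Q_def)
      have "W b \<omega> = (\<Prod>i\<in>H - S. indicator UNIV (p i \<omega>) + (b - 1) * indicator {..a} (p i \<omega>))
          * (\<Prod>i\<in>S. indicator UNIV (p i \<omega>) + (b - 1) * indicator {..a} (p i \<omega>))"
        unfolding W_def by (rule prod.subset_diff[OF SH fin])
      also have "(\<Prod>i\<in>H - S. indicator UNIV (p i \<omega>) + (b - 1) * indicator {..a} (p i \<omega>)) = 1"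
        using * at by (intro prod.neutral) (force simp: indicator_def)
      also have "(\<Prod>i\<in>S. indicator UNIV (p i \<omega>) + (b - 1) * indicator {..a} (p i \<omega>))
          = (\<Prod>i\<in>S. indicator {..t} (p i \<omega>) + (b - 1) * indicator {..a} (p i \<omega>))"
        using * by (intro prod.cong) (auto simp: indicator_def)
      finally show ?thesis using True * by (simp add: g_def restr_Q)
    next
      case False
      then consider i where "i \<in> S" "t < p i \<omega>" | "\<not> Q (\<lambda>i. p i \<omega>)"
        using E_iff[OF \<omega>] by (auto simp: not_le)
      then show ?thesis
      proof cases
        case 1
        then have "(\<Prod>i\<in>S. indicator {..t} (p i \<omega>) + (b - 1) * indicator {..a} (p i \<omega>)) = 0"
          using finS at by (intro prod_zero bexI[of _ i]) (auto simp: indicator_def)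
        then show ?thesis using False by simp
      qed (use False in \<open>simp add: g_def restr_Q\<close>)
    qed
    let ?G = "expectation (\<lambda>\<omega>. g (restrict (\<lambda>i. p i \<omega>) (H - S)))"
    have "expectation (\<lambda>\<omega>. W b \<omega> * indicator (E S) \<omega>) = (t + (b - 1) * a) ^ card S * ?G" for b
    proof -
      have "expectation (\<lambda>\<omega>. W b \<omega> * indicator (E S) \<omega>) = expectation (\<lambda>\<omega>.
          (\<Prod>i\<in>S. indicator {..t} (p i \<omega>) + (b - 1) * indicator {..a} (p i \<omega>))
          * g (restrict (\<lambda>i. p i \<omega>) (H - S)))"
        by (intro Bochner_Integration.integral_cong refl ident)
      also have "\<dots> = (\<Prod>i\<in>S. expectation (\<lambda>\<omega>. indicator {..t} (p i \<omega>)
          + (b - 1) * indicator {..a} (p i \<omega>))) * ?G"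
        by (rule indep_vars_expectation_prod_times[OF indep fin SH, where B="1 + \<bar>b - 1\<bar>" and C=1])
           (auto simp: indicator_def gm gB)
      also have "(\<Prod>i\<in>S. expectation (\<lambda>\<omega>. indicator {..t} (p i \<omega>)
          + (b - 1) * indicator {..a} (p i \<omega>))) = (\<Prod>i\<in>S. t + (b - 1) * a)"
      proof (rule prod.cong)
        fix i assume "i \<in> S"
        then have i: "i \<in> H" using SH by auto
        show "expectation (\<lambda>\<omega>. indicator {..t} (p i \<omega>) + (b - 1) * indicator {..a} (p i \<omega>))
            = t + (b - 1) * a"
          using a at t1 uniform_prob_le[OF p[OF i] unif[OF i], of t]
          by (subst uniform_expectation_indicators[OF p[OF i] unif[OF i]]) auto
      qed simp
      finally show ?thesis by (simp only: prod_constant)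
    qed
    moreover have "0 \<le> ?G" by (rule Bochner_Integration.integral_nonneg) (simp add: g_def)
    ultimately show ?thesis unfolding t_def by blast
  qed
  have E_bound: "exp (r * c * a) * prob (E S) \<le> expectation (\<lambda>\<omega>. W (exp r) \<omega> * indicator (E S) \<omega>)"
    if S: "S \<in> F" for S
  proof -
    define t where "t = card S / c"
    have SH: "S \<subseteq> H" and cak: "c * a \<le> card S" using S by (auto simp: F_def)
    have at: "a \<le> t" using cak c0 by (simp add: t_def field_simps)
    have t0: "0 < t" using at a by linarith
    obtain G where G: "0 \<le> G" "\<And>b. expectation (\<lambda>\<omega>. W b \<omega> * indicator (E S) \<omega>)
      = (t + (b - 1) * a) ^ card S * G" using key[OF S] unfolding t_def by blast
    \<comment> \<open>At \<open>b = 1\<close> the weight is constantly 1.\<close>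
    have "prob (E S) = t ^ card S * G"
      using G(2)[of 1] Em[OF SH] by (simp add: W_def)
    \<comment> \<open>A point uniform on the interval from 0 to \<open>t\<close> falls below
      \<open>a\<close> with probability \<open>a / t\<close>, so the chord bound applies with
      \<open>u = a / t\<close>. Since \<open>card S = c * t\<close>, the \<open>card S\<close>-th
      power produces the exponent \<open>r * c * a\<close>.\<close>
    moreover have "exp (r * c * a) * t ^ card S \<le> (t + (exp r - 1) * a) ^ card S"
    proof -
      have "t * exp (a / t * r) \<le> t * (1 + a / t * (exp r - 1))"
        using at a t0 by (intro mult_left_mono exp_mult_le_chord) auto
      also have "\<dots> = t + (exp r - 1) * a" using t0 by (simp add: field_simps)
      finally have "(t * exp (a / t * r)) ^ card S \<le> (t + (exp r - 1) * a) ^ card S"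
        using t0 by (intro power_mono) auto
      moreover have "real (card S) * (a / t * r) = r * c * a"
        using t0 c0 by (simp add: t_def field_simps)
      ultimately show ?thesis
        by (simp add: power_mult_distrib mult.commute flip: exp_of_nat_mult)
    qed
    ultimately show ?thesis
      using mult_right_mono[OF _ G(1)] by (simp add: G(2) mult.assoc[symmetric])
  qed
  \<comment> \<open>For sets of different size, the larger one would be a crossing later than the
    last one; for equal size, both equal the same set of points.\<close>
  have disj: "disjoint_family_on E F"
  proof -
    have "\<omega> \<notin> E T" if "S \<in> F" "T \<in> F" "card S < card T" "\<omega> \<in> E S" for S T \<omega>
    proof
      assume "\<omega> \<in> E T"
      then have "card {i \<in> H. p i \<omega> \<le> card T / c} = card T" by (simp add: E_def)
      moreover have "card T \<le> card H" using that fin by (auto simp: F_def intro: card_mono)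
      moreover have "\<forall>l\<in>{card S<..card H}. card {i \<in> H. p i \<omega> \<le> real l / c} < l"
        using \<open>\<omega> \<in> E S\<close> by (simp add: E_def)
      then have "card T \<in> {card S<..card H} \<Longrightarrow> card {i \<in> H. p i \<omega> \<le> card T / c} < card T"
        by (rule bspec)
      ultimately show False using \<open>card S < card T\<close> by simp
    qed
    moreover have "S = T" if "card S = card T" "\<omega> \<in> E S" "\<omega> \<in> E T" for S T \<omega>
      using that unfolding E_def by auto
    ultimately show ?thesis
      unfolding disjoint_family_on_def by (metis disjoint_iff linorder_neqE_nat)
  qed
  have cover: "{\<omega> \<in> space M. \<exists>k\<in>{..card H}. c * a \<le> k \<and> k \<le> card {i \<in> H. p i \<omega> \<le> real k / c}}
      \<subseteq> (\<Union>S\<in>F. E S)"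
  proof safe
    fix \<omega> k assume \<omega>: "\<omega> \<in> space M"
      and k: "k \<le> card H" "c * a \<le> real k" "k \<le> card {i \<in> H. p i \<omega> \<le> real k / c}"
    \<comment> \<open>The condition \<open>k \<le> l\<close> carries the lower bound
      \<open>c * a\<close> over to the maximal \<open>l\<close>.\<close>
    define P where "P l \<longleftrightarrow> l \<le> card H \<and> k \<le> l \<and> l \<le> card {i \<in> H. p i \<omega> \<le> real l / c}" for l
    define l where "l = Greatest P"
    have "P k" using k by (simp add: P_def)
    then have Pl: "P l"
      unfolding l_def by (rule GreatestI_nat[where b="card H"]) (simp add: P_def)
    have max: "j \<le> l" if "P j" for j
      unfolding l_def using that by (rule Greatest_le_nat[where b="card H"]) (simp add: P_def)
    define S where "S = {i \<in> H. p i \<omega> \<le> real l / c}"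
    have "card S = l"
    proof (rule ccontr)
      \<comment> \<open>A surplus of points at \<open>l / c\<close> makes \<open>Suc l\<close> a
        crossing as well, because the count does not decrease at the next threshold.\<close>
      assume "card S \<noteq> l"
      then have Sl: "Suc l \<le> card S" using Pl by (auto simp: P_def S_def)
      also have "card S \<le> card {i \<in> H. p i \<omega> \<le> real (Suc l) / c}"
        unfolding S_def using fin c0
        by (intro card_mono) (auto intro: order.trans simp: divide_right_mono)
      finally have "Suc l \<le> card {i \<in> H. p i \<omega> \<le> real (Suc l) / c}" .
      moreover have "card S \<le> card H" unfolding S_def using fin by (intro card_mono) auto
      ultimately have "P (Suc l)" using Sl Pl by (auto simp: P_def)
      then show False using max by fastforce
    qed
    moreover have "card {i \<in> H. p i \<omega> \<le> real j / c} < j" if "l < j" "j \<le> card H" for j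
      using max[of j] that Pl by (auto simp: P_def not_le[symmetric])
    ultimately have "\<omega> \<in> E S" using \<omega> by (auto simp: E_def S_def)
    moreover have "S \<in> F" using \<open>card S = l\<close> Pl k by (auto simp: F_def P_def S_def)
    ultimately show "\<omega> \<in> (\<Union>S\<in>F. E S)" by blast
  qed
  have EF: "E ` F \<subseteq> sets M" using Em by (auto simp: F_def)
  have "exp (r * c * a) * prob (\<Union>S\<in>F. E S) = (\<Sum>S\<in>F. exp (r * c * a) * prob (E S))"
    using finite_measure_finite_Union[OF finF EF disj] by (simp add: sum_distrib_left)
  also have "\<dots> \<le> (\<Sum>S\<in>F. expectation (\<lambda>\<omega>. W (exp r) \<omega> * indicator (E S) \<omega>))"
    by (intro sum_mono E_bound)
  also have "\<dots> = expectation (\<lambda>\<omega>. \<Sum>S\<in>F. W (exp r) \<omega> * indicator (E S) \<omega>)"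
    using EF r by (intro Bochner_Integration.integral_sum[symmetric] integrable_real_mult_indicator Wint) auto
  \<comment> \<open>The \<open>E S\<close> are disjoint and the weight is nonnegative, so at most
    the whole mean is collected.\<close>
  also have "\<dots> \<le> expectation (W (exp r))"
  proof (rule integral_mono)
    show "(\<Sum>S\<in>F. W (exp r) \<omega> * indicator (E S) \<omega>) \<le> W (exp r) \<omega>" for \<omega>
    proof -
      have "(\<Sum>S\<in>F. indicator (E S) \<omega>) = (indicator (\<Union>S\<in>F. E S) \<omega> :: real)"
        by (rule indicator_UN_disjoint[OF finF disj, symmetric])
      also have "\<dots> \<le> 1" by (simp add: indicator_def)
      finally show ?thesis
        using mult_left_mono[OF _ W_nonneg[of "exp r" \<omega>], of _ 1] r
        by (simp flip: sum_distrib_left)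
    qed
    show "integrable M (\<lambda>\<omega>. \<Sum>S\<in>F. W (exp r) \<omega> * indicator (E S) \<omega>)"
      using EF r by (intro Bochner_Integration.integrable_sum integrable_real_mult_indicator Wint) auto
  qed (use r Wint in auto)
  also have "\<dots> \<le> exp ((exp r - 1) * a) ^ card H"
    unfolding EW using a r by (intro power_mono exp_ge_add_one_self) auto
  also have "\<dots> = exp (card H * a * (exp r - 1))"
    by (simp add: mult_ac flip: exp_of_nat_mult)
  finally have "prob (\<Union>S\<in>F. E S) \<le> exp (card H * a * (exp r - 1)) / exp (r * c * a)"
    by (simp add: field_simps)
  moreover have "prob {\<omega> \<in> space M. \<exists>k\<in>{..card H}. c * a \<le> k \<and> k \<le> card {i \<in> H. p i \<omega> \<le> real k / c}}
      \<le> prob (\<Union>S\<in>F. E S)"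
    using cover EF finF by (intro finite_measure_mono sets.finite_UN) auto
  ultimately show ?thesis by (simp add: exp_diff)
qed

end

section \<open>Wellner's bound for the empirical ratio\<close>

text \<open>The value \<open>r = ln l\<close> minimises
  \<open>m * a * (exp r - 1) - r * m * l * a\<close>, and the minimum is
  \<open>- (m * a * h_fun l)\<close>. Passing from \<open>card H\<close> to \<open>m\<close> only
  enlarges the exponent because \<open>l > 1\<close>.\<close>

lemma (in prob_space) prob_empirical_ratio_le:
  fixes p :: "nat \<Rightarrow> 'a \<Rightarrow> real" and a l :: real
  assumes indep: "indep_vars (\<lambda>_. borel) p H" and fin: "finite H"
    and unif: "\<And>i. i \<in> H \<Longrightarrow> distr M borel (p i) = uniform_measure lborel {0..1}"
    and a: "0 < a" "a \<le> 1" and l: "1 < l" and m: "card H \<le> m" "0 < m"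
  shows "prob {\<omega> \<in> space M. \<exists>k\<in>{..card H}. m * l * a \<le> k \<and> k \<le> card {i \<in> H. p i \<omega> \<le> real k / (m * l)}}
       \<le> exp (- (m * a * h_fun l))"
proof -
  have "real m * 1 < real m * l" using l m by (intro mult_strict_left_mono) auto
  then have c: "real (card H) < m * l" using m by linarith
  have "prob {\<omega> \<in> space M. \<exists>k\<in>{..card H}. m * l * a \<le> k \<and> k \<le> card {i \<in> H. p i \<omega> \<le> real k / (m * l)}}
      \<le> exp (card H * a * (exp (ln l) - 1) - ln l * (m * l) * a)"
    using l by (intro prob_empirical_crossing_le indep fin unif a c) auto
  also have "card H * a * (exp (ln l) - 1) \<le> m * a * (l - 1)"
    using a l m by (intro mult_mono) auto
  then have "card H * a * (exp (ln l) - 1) - ln l * (m * l) * a \<le> - (m * a * h_fun l)"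
    by (simp add: h_fun_def algebra_simps)
  finally show ?thesis by simp
qed

section \<open>Dyadic levels and the argument of \<open>h_inv\<close>\<close>

text \<open>For every \<open>\<delta> < 1\<close> this makes the logarithms positive, as the domain
  of \<open>h_inv\<close> requires.\<close>

lemma one_less_pi_squared_div_6: "1 < pi\<^sup>2 / 6"
proof -
  have "3\<^sup>2 < pi\<^sup>2" using pi_gt3 by (intro power_strict_mono) auto
  then show ?thesis by simp
qed

lemma FDP_Well_arg_pos:
  fixes \<delta> q :: real
  assumes "0 < \<delta>" "\<delta> < 1" "0 < q" "q \<le> 1" "0 < m"
  shows "0 < (2 * ln (pi\<^sup>2 / 6 / \<delta>) + 4 * ln (1 + log 2 (1 / q))) / (real m * q)"
proof -
  have "1 < pi\<^sup>2 / 6 / \<delta>" using assms one_less_pi_squared_div_6 by (simp add: field_simps)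
  then have "0 < ln (pi\<^sup>2 / 6 / \<delta>)" by (rule ln_gt_zero)
  moreover have "0 \<le> log 2 (1 / q)" using assms by (subst zero_le_log_cancel_iff) auto
  ultimately show ?thesis using assms by (intro divide_pos_pos add_pos_nonneg) auto
qed

text \<open>The level \<open>l\<close> at which Wellner's bound for \<open>a = 2\<^sup>-\<^sup>j\<^sup>-\<^sup>1\<close> equals \<open>\<delta> / (\<kappa> * (j + 1)\<^sup>2)\<close>.\<close>
definition dyadic_level :: "real \<Rightarrow> nat \<Rightarrow> nat \<Rightarrow> real" where
  "dyadic_level \<delta> m j = h_inv (ln (pi\<^sup>2 / 6 * (real (Suc j))\<^sup>2 / \<delta>) / (m * (1 / 2) ^ Suc j))"

lemma dyadic_level_arg_pos:
  fixes m :: nat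
  assumes "0 < \<delta>" "\<delta> < 1" "0 < m"
  shows "0 < ln (pi\<^sup>2 / 6 * (real (Suc j))\<^sup>2 / \<delta>) / (m * (1 / 2) ^ Suc j)"
proof -
  have "1 * 1 < pi\<^sup>2 / 6 * (real (Suc j))\<^sup>2"
    using one_less_pi_squared_div_6 by (intro mult_less_le_imp_less) auto
  then have "1 < pi\<^sup>2 / 6 * (real (Suc j))\<^sup>2 / \<delta>" using assms by (simp add: field_simps)
  then show ?thesis using assms by (intro divide_pos_pos ln_gt_zero) auto
qed

text \<open>With \<open>j\<close> the integer part of \<open>log 2 (1 / q)\<close>, the point
  \<open>(1 / 2) ^ Suc j\<close> lies between \<open>q / 2\<close> and \<open>q\<close>. Replacing
  it by \<open>q / 2\<close> in the denominator doubles the logarithm, and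
  \<open>Suc j \<le> 1 + log 2 (1 / q)\<close> enters squared; hence the constants 2 and 4.\<close>

lemma dyadic_level_le:
  assumes \<delta>: "0 < \<delta>" "\<delta> < 1" and m: "0 < m" and q: "0 < q" "q \<le> 1"
  obtains j where "(1 / 2) ^ Suc j \<le> q"
    and "dyadic_level \<delta> m j
      \<le> h_inv ((2 * ln (pi\<^sup>2 / 6 / \<delta>) + 4 * ln (1 + log 2 (1 / q))) / (real m * q))"
proof -
  define y where "y = log 2 (1 / q)"
  define j where "j = nat \<lfloor>y\<rfloor>"
  have y0: "0 \<le> y" using q unfolding y_def by (subst zero_le_log_cancel_iff) auto
  have jy: "real j \<le> y" "y < real (Suc j)" using y0 unfolding j_def by linarith+
  have qy: "q = 2 powr (- y)" using q by (simp add: y_def log_divide powr_minus)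
  have pw: "(1 / 2) ^ i = 2 powr (- real i)" for i :: nat
    by (simp add: powr_minus powr_realpow power_one_over inverse_eq_divide)
  have lo: "(1 / 2) ^ Suc j \<le> q" unfolding qy pw using jy by (intro powr_mono) auto
  have "q \<le> (1 / 2) ^ j" unfolding qy pw using jy by (intro powr_mono) auto
  then have hi: "q / 2 \<le> (1 / 2) ^ Suc j" by simp
  define L where "L = ln (pi\<^sup>2 / 6 * (real (Suc j))\<^sup>2 / \<delta>)"
  have L0: "0 < L"
    using dyadic_level_arg_pos[OF \<delta> m, of j] m
    by (simp add: L_def zero_less_divide_iff mult_less_0_iff)
  have "L = ln (pi\<^sup>2 / 6 / \<delta>) + 2 * ln (Suc j)"
  proof -
    have "L = ln (pi\<^sup>2 / 6 / \<delta> * (real (Suc j))\<^sup>2)" by (simp add: L_def)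
    also have "\<dots> = ln (pi\<^sup>2 / 6 / \<delta>) + ln ((real (Suc j))\<^sup>2)"
      using \<delta> by (intro ln_mult_pos) auto
    finally show ?thesis by (simp add: ln_realpow)
  qed
  moreover have "ln (Suc j) \<le> ln (1 + y)" using jy by simp
  ultimately have "2 * L \<le> 2 * ln (pi\<^sup>2 / 6 / \<delta>) + 4 * ln (1 + y)" by simp
  then have "2 * L / (m * q) \<le> (2 * ln (pi\<^sup>2 / 6 / \<delta>) + 4 * ln (1 + y)) / (m * q)"
    using m q by (intro divide_right_mono) auto
  moreover have "L / (m * (1 / 2) ^ Suc j) \<le> L / (m * (q / 2))"
    using hi L0 m q by (intro divide_left_mono mult_left_mono mult_pos_pos) auto
  ultimately have "L / (m * (1 / 2) ^ Suc j) \<le> (2 * ln (pi\<^sup>2 / 6 / \<delta>) + 4 * ln (1 + y)) / (m * q)"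
    by (simp add: mult_ac)
  then have "dyadic_level \<delta> m j
      \<le> h_inv ((2 * ln (pi\<^sup>2 / 6 / \<delta>) + 4 * ln (1 + log 2 (1 / q))) / (real m * q))"
    unfolding dyadic_level_def y_def L_def
    using dyadic_level_arg_pos[OF \<delta> m] by (intro h_inv_mono) auto
  with lo show ?thesis by (rule that)
qed

section \<open>The deterministic comparison\<close>

lemma FDP_le_1: "FDP H0 (top_k m x k) \<le> 1"
proof -
  have "card (top_k m x k \<inter> H0) \<le> card (top_k m x k)"
    by (intro card_mono) (auto simp: top_k_def)
  then show ?thesis by (simp add: FDP_def)
qed

text \<open>Ties can only enlarge \<open>top_k\<close> beyond \<open>k\<close> elements, so
  \<open>k\<close> is a valid lower bound for the denominator.\<close>

lemma FDP_top_k_le: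
  assumes k: "k \<in> {1..m}" and H0: "H0 \<subseteq> {1..m}"
  shows "FDP H0 (top_k m x k) \<le> card {i \<in> H0. x i \<le> order_stat m x k} / k"
proof -
  have "top_k m x k \<inter> H0 = {i \<in> H0. x i \<le> order_stat m x k}"
    using H0 by (auto simp: top_k_def)
  moreover have "k \<le> card (top_k m x k)"
    using order_stat_le_iff[OF k, of x "order_stat m x k"] by (simp add: top_k_def)
  ultimately show ?thesis
    using k unfolding FDP_def by (auto intro!: divide_left_mono)
qed

text \<open>The pointwise part of the proof. Positivity of the null values settles
  \<open>q = 0\<close>, where the bound is 0 and no null lies at or below \<open>q\<close>.
  Otherwise the dyadic level belonging to \<open>q\<close> controls the number of nulls up to
  \<open>q\<close>.\<close>

lemma FDP_le_FDP_Well: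
  assumes k: "k \<in> {1..m}" and H0: "H0 \<subseteq> {1..m}" and \<delta>: "0 < \<delta>" "\<delta> < 1"
    and x: "\<And>i. i \<in> {1..m} \<Longrightarrow> x i \<in> {0..1}" and pos: "\<And>i. i \<in> H0 \<Longrightarrow> 0 < x i"
    and no_crossing: "\<And>j l. \<lbrakk>l \<le> card H0; m * dyadic_level \<delta> m j * (1 / 2) ^ Suc j \<le> real l\<rbrakk>
      \<Longrightarrow> card {i \<in> H0. x i \<le> real l / (m * dyadic_level \<delta> m j)} < l"
  shows "FDP H0 (top_k m x k) \<le> FDP_Well \<delta> m x k"
proof -
  define q where "q = order_stat m x k"
  define N where "N = card {i \<in> H0. x i \<le> q}"
  have finH: "finite H0" using H0 finite_subset by blast
  have m: "0 < m" using k by auto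
  have q: "0 \<le> q" "q \<le> 1" using order_stat_mem[OF k, of x] x unfolding q_def by force+
  have FN: "FDP H0 (top_k m x k) \<le> N / k"
    using FDP_top_k_le[OF k H0] by (simp add: N_def q_def)
  show ?thesis
  proof (cases "q = 0")
    case True
    then have "{i \<in> H0. x i \<le> q} = {}" using pos by force
    then have "N = 0" unfolding N_def by (simp only: card.empty)
    then show ?thesis using FN True by (simp add: FDP_Well_def q_def)
  next
    case False
    then have q0: "0 < q" using q by simp
    define B where "B = h_inv ((2 * ln (pi\<^sup>2 / 6 / \<delta>) + 4 * ln (1 + log 2 (1 / q))) / (real m * q))"
    obtain j where j: "(1 / 2) ^ Suc j \<le> q" "dyadic_level \<delta> m j \<le> B"
      using dyadic_level_le[OF \<delta> m q0 q(2)] unfolding B_def by blast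
    have lev: "1 < dyadic_level \<delta> m j"
      unfolding dyadic_level_def by (rule h_inv_gt_1[OF dyadic_level_arg_pos[OF \<delta> m]])
    define c where "c = m * dyadic_level \<delta> m j"
    have c0: "0 < c" using lev m by (simp add: c_def)
    have "N \<le> c * q"
    proof (rule ccontr)
      \<comment> \<open>If \<open>N > c * q\<close>, the ratio is still exceeded at the later threshold \<open>N / c\<close>.\<close>
      assume "\<not> N \<le> c * q"
      then have gt: "c * q < N" by simp
      have "c * (1 / 2) ^ Suc j \<le> c * q" using j c0 by (intro mult_left_mono) auto
      then have "c * (1 / 2) ^ Suc j \<le> N" using gt by linarith
      moreover have "N \<le> card H0" unfolding N_def using finH by (intro card_mono) auto
      ultimately have "card {i \<in> H0. x i \<le> real N / c} < N"
        using no_crossing unfolding c_def by blast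
      moreover have "q \<le> real N / c" using gt c0 by (simp add: field_simps)
      then have "N \<le> card {i \<in> H0. x i \<le> real N / c}"
        unfolding N_def using finH by (intro card_mono) (auto simp: N_def[symmetric])
      ultimately show False by simp
    qed
    also have "c * q \<le> m * B * q"
      unfolding c_def using j q m by (intro mult_right_mono mult_left_mono) auto
    finally have "N / k \<le> m * B * q / k" using k by (intro divide_right_mono) auto
    then have "FDP H0 (top_k m x k) \<le> m * q / k * B" using FN by (simp add: mult_ac)
    then show ?thesis
      using FDP_le_1[of H0 m x k] False by (simp add: FDP_Well_def Let_def q_def[symmetric] B_def)
  qed
qed

section \<open>Measurability of both sides of the inequality\<close>

lemma borel_measurable_order_stat:
  assumes p: "\<And>i. i \<in> {1..m} \<Longrightarrow> p i \<in> borel_measurable M" and k: "k \<in> {1..m}"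
  shows "(\<lambda>\<omega>. order_stat m (\<lambda>i. p i \<omega>) k) \<in> borel_measurable M"
proof (rule borel_measurableI_le)
  fix t
  have [measurable]: "(\<lambda>\<omega>. card {i \<in> {1..m}. p i \<omega> \<le> t}) \<in> measurable M (count_space UNIV)"
    by (rule measurable_card_le[OF p]) auto
  show "{\<omega> \<in> space M. order_stat m (\<lambda>i. p i \<omega>) k \<le> t} \<in> sets M"
    unfolding order_stat_le_iff[OF k] by measurable
qed

lemma borel_measurable_FDP_top_k:
  assumes p: "\<And>i. i \<in> {1..m} \<Longrightarrow> p i \<in> borel_measurable M" and k: "k \<in> {1..m}"
  shows "(\<lambda>\<omega>. FDP H0 (top_k m (\<lambda>i. p i \<omega>) k)) \<in> borel_measurable M"
proof -
  have eq: "top_k m (\<lambda>i. p i \<omega>) k \<inter> H0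
      = {i \<in> {1..m} \<inter> H0. p i \<omega> \<le> order_stat m (\<lambda>i. p i \<omega>) k}" for \<omega>
    by (auto simp: top_k_def)
  have cards: "(\<lambda>\<omega>. card {i \<in> A. p i \<omega> \<le> order_stat m (\<lambda>i. p i \<omega>) k})
      \<in> measurable M (count_space UNIV)" if "A \<subseteq> {1..m}" for A
    using that by (intro measurable_card_le p borel_measurable_order_stat k) blast
  have 1: "(\<lambda>\<omega>. card (top_k m (\<lambda>i. p i \<omega>) k \<inter> H0)) \<in> measurable M (count_space UNIV)"
    unfolding eq by (rule cards) blast
  have 2: "(\<lambda>\<omega>. card (top_k m (\<lambda>i. p i \<omega>) k)) \<in> measurable M (count_space UNIV)"
    unfolding top_k_def by (rule cards) blast
  show ?thesis
    unfolding FDP_def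
    by (intro borel_measurable_divide measurable_compose[OF 1]
        measurable_compose[OF 2, where g="\<lambda>n. real (max n 1)"]) auto
qed

lemma borel_measurable_FDP_Well:
  assumes p: "\<And>i. i \<in> {1..m} \<Longrightarrow> p i \<in> borel_measurable M" and k: "k \<in> {1..m}"
    and \<delta>: "0 < \<delta>" "\<delta> < 1"
    and p01: "\<And>i \<omega>. i \<in> {1..m} \<Longrightarrow> \<omega> \<in> space M \<Longrightarrow> p i \<omega> \<in> {0..1}"
  shows "(\<lambda>\<omega>. FDP_Well \<delta> m (\<lambda>i. p i \<omega>) k) \<in> borel_measurable M"
proof -
  note [measurable] = borel_measurable_order_stat[OF p k]
  \<comment> \<open>\<open>h_inv\<close> is replaced by its monotone extension. The two agree at the
    values that occur, since for \<open>0 < q \<le> 1\<close> the argument is positive.\<close>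
  define F where "F q = (if q = 0 then 0 else min 1 (real m * q / real k *
    (\<lambda>y. if 0 < y then h_inv y else 1)
      ((2 * ln (pi\<^sup>2 / 6 / \<delta>) + 4 * ln (1 + log 2 (1 / q))) / (real m * q))))" for q
  have [measurable]: "F \<in> borel_measurable borel"
    unfolding F_def[abs_def]
    by (intro measurable_If borel_measurable_min borel_measurable_times
        measurable_compose[OF _ borel_measurable_h_inv_pos]) measurable
  have "FDP_Well \<delta> m (\<lambda>i. p i \<omega>) k = F (order_stat m (\<lambda>i. p i \<omega>) k)" if \<omega>: "\<omega> \<in> space M" for \<omega>
  proof -
    have "order_stat m (\<lambda>i. p i \<omega>) k \<in> {0..1}"
      using order_stat_mem[OF k, of "\<lambda>i. p i \<omega>"] p01[OF _ \<omega>] by force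
    then show ?thesis
      using FDP_Well_arg_pos[OF \<delta>, of "order_stat m (\<lambda>i. p i \<omega>) k" m] k
      by (auto simp: FDP_Well_def F_def Let_def)
  qed
  then show ?thesis by (subst measurable_cong) auto
qed

section \<open>Union bound over the dyadic levels\<close>

theorem theorem7:
  fixes M :: "'a measure" and p :: "nat \<Rightarrow> 'a \<Rightarrow> real"
    and m :: nat and H0 :: "nat set" and \<delta> :: real
  assumes "prob_space M"
    and "H0 \<subseteq> {1..m}" and "0 < card H0" and "card H0 < m"
    and "\<And>i \<omega>. i \<in> {1..m} \<Longrightarrow> \<omega> \<in> space M \<Longrightarrow> p i \<omega> \<in> {0..1}"
    and "prob_space.indep_vars M (\<lambda>_. borel) p {1..m}"
    and "\<And>i. i \<in> H0 \<Longrightarrow> distr M borel (p i) = uniform_measure lborel {0..1}"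
    and "0 < \<delta>" and "\<delta> < 1"
  shows "measure M {\<omega> \<in> space M. \<forall>k\<in>{1..m}.
           FDP H0 (top_k m (\<lambda>i. p i \<omega>) k) \<le> FDP_Well \<delta> m (\<lambda>i. p i \<omega>) k} \<ge> 1 - \<delta>"
proof -
  interpret prob_space M by fact
  note H0 = assms(2) and p01 = assms(5) and unif = assms(7) and \<delta> = assms(8,9)
  have finH: "finite H0" using H0 finite_subset by blast
  have m: "0 < m" and Hm: "card H0 \<le> m" using assms(3,4) by auto
  have p: "p i \<in> borel_measurable M" if "i \<in> {1..m}" for i
    using assms(6) that by (auto simp: indep_vars_def)
  have indep: "indep_vars (\<lambda>_. borel) p H0" by (rule indep_vars_subset[OF assms(6) H0])
  define good where "good = {\<omega> \<in> space M. \<forall>k\<in>{1..m}.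
    FDP H0 (top_k m (\<lambda>i. p i \<omega>) k) \<le> FDP_Well \<delta> m (\<lambda>i. p i \<omega>) k}"
  \<comment> \<open>Measurability is needed to pass to the complement at the end.\<close>
  have good: "good \<in> sets M"
    unfolding good_def
    using borel_measurable_FDP_top_k[OF p] borel_measurable_FDP_Well[OF p _ \<delta> p01]
    by (intro sets.sets_Collect_finite_All borel_measurable_le) auto
  define lev where "lev = dyadic_level \<delta> m"
  define bad where "bad j = {\<omega> \<in> space M. \<exists>k\<in>{..card H0}.
    m * lev j * (1 / 2) ^ Suc j \<le> k \<and> k \<le> card {i \<in> H0. p i \<omega> \<le> real k / (m * lev j)}}" for j
  \<comment> \<open>A null event, removed because the bound is 0 when \<open>order_stat\<close> is
    0.\<close>
  define Z where "Z = (\<Union>i\<in>H0. {\<omega> \<in> space M. p i \<omega> \<le> 0})"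
  have [measurable]: "(\<lambda>\<omega>. card {i \<in> H0. p i \<omega> \<le> t}) \<in> measurable M (count_space UNIV)" for t
    using H0 by (intro measurable_card_le p) auto
  have bad_sets: "bad j \<in> sets M" for j
  proof -
    have "{\<omega> \<in> space M. k \<le> card {i \<in> H0. p i \<omega> \<le> t}} \<in> sets M" for k :: nat and t
      by measurable
    then have "(\<Union>k\<in>{k. k \<le> card H0 \<and> m * lev j * (1 / 2) ^ Suc j \<le> k}.
        {\<omega> \<in> space M. k \<le> card {i \<in> H0. p i \<omega> \<le> real k / (m * lev j)}}) \<in> sets M"
      by (intro sets.finite_UN) auto
    also have "(\<Union>k\<in>{k. k \<le> card H0 \<and> m * lev j * (1 / 2) ^ Suc j \<le> k}.
        {\<omega> \<in> space M. k \<le> card {i \<in> H0. p i \<omega> \<le> real k / (m * lev j)}}) = bad j"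
      unfolding bad_def by blast
    finally show ?thesis .
  qed
  have prob_bad: "prob (bad j) \<le> \<delta> / (pi\<^sup>2 / 6) * (1 / (real j + 1)\<^sup>2)" for j
  proof -
    let ?a = "(1 / 2 :: real) ^ Suc j"
    have "prob (bad j) \<le> exp (- (m * ?a * h_fun (lev j)))"
      unfolding bad_def lev_def dyadic_level_def
      by (intro prob_empirical_ratio_le indep finH unif h_inv_gt_1 dyadic_level_arg_pos \<delta> m Hm)
         (auto intro!: power_le_one simp del: power_Suc)
    also have "m * ?a * h_fun (lev j) = ln (pi\<^sup>2 / 6 * (real (Suc j))\<^sup>2 / \<delta>)"
      unfolding lev_def dyadic_level_def using m
      by (subst h_fun_h_inv[OF dyadic_level_arg_pos[OF \<delta> m]]) (simp del: power_Suc)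
    also have "exp (- ln (pi\<^sup>2 / 6 * (real (Suc j))\<^sup>2 / \<delta>)) = \<delta> / (pi\<^sup>2 / 6) * (1 / (real j + 1)\<^sup>2)"
      using \<delta> by (simp add: exp_minus field_simps)
    finally show ?thesis .
  qed
  \<comment> \<open>The reciprocals of the squares sum to \<open>pi\<^sup>2 / 6\<close>, which is
    the role of \<open>\<kappa>\<close> in the bound.\<close>
  have sums: "(\<lambda>j. \<delta> / (pi\<^sup>2 / 6) * (1 / (real j + 1)\<^sup>2)) sums \<delta>"
    using sums_mult[OF inverse_squares_sums, of "\<delta> / (pi\<^sup>2 / 6)"]
    by (simp add: add.commute)
  have summ: "summable (\<lambda>j. prob (bad j))"
    using prob_bad by (intro summable_comparison_test[OF _ sums_summable[OF sums]]) auto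
  have "prob (\<Union>j. bad j) \<le> (\<Sum>j. prob (bad j))"
    using bad_sets summ by (intro finite_measure_subadditive_countably) auto
  also have "\<dots> \<le> (\<Sum>j. \<delta> / (pi\<^sup>2 / 6) * (1 / (real j + 1)\<^sup>2))"
    by (intro suminf_le prob_bad summ sums_summable[OF sums])
  also have "\<dots> = \<delta>" using sums by (rule sums_unique[symmetric])
  finally have prob_Bad: "prob (\<Union>j. bad j) \<le> \<delta>" .
  have Z_sets: "Z \<in> sets M" unfolding Z_def using finH p H0 by (intro sets.finite_UN) auto
  have "prob Z \<le> (\<Sum>i\<in>H0. prob {\<omega> \<in> space M. p i \<omega> \<le> 0})"
    unfolding Z_def using finH p H0 by (intro finite_measure_subadditive_finite) auto
  also have "\<dots> = 0"
    using p H0 unif by (intro sum.neutral ballI uniform_prob_le) auto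
  finally have prob_Z: "prob Z \<le> 0" .
  have "space M - good \<subseteq> Z \<union> (\<Union>j. bad j)"
  proof
    fix \<omega> assume \<omega>: "\<omega> \<in> space M - good"
    show "\<omega> \<in> Z \<union> (\<Union>j. bad j)"
    proof (rule ccontr)
      assume not: "\<omega> \<notin> Z \<union> (\<Union>j. bad j)"
      have "FDP H0 (top_k m (\<lambda>i. p i \<omega>) k) \<le> FDP_Well \<delta> m (\<lambda>i. p i \<omega>) k" if "k \<in> {1..m}" for k
      proof (rule FDP_le_FDP_Well[OF that H0 \<delta>])
        show "p i \<omega> \<in> {0..1}" if "i \<in> {1..m}" for i using p01 that \<omega> by auto
        show "0 < p i \<omega>" if "i \<in> H0" for i using not \<omega> that by (force simp: Z_def)
        show "card {i \<in> H0. p i \<omega> \<le> real l / (m * dyadic_level \<delta> m j)} < l"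
          if "l \<le> card H0" "m * dyadic_level \<delta> m j * (1 / 2) ^ Suc j \<le> real l" for j l
        proof -
          have "\<omega> \<notin> bad j" using not by blast
          then show ?thesis
            using that \<omega> unfolding bad_def lev_def by (auto simp: not_le[symmetric] simp del: power_Suc)
        qed
      qed
      then show False using \<omega> by (auto simp: good_def)
    qed
  qed
  then have "prob (space M - good) \<le> prob (Z \<union> (\<Union>j. bad j))"
    using Z_sets bad_sets by (intro finite_measure_mono) auto
  also have "\<dots> \<le> prob Z + prob (\<Union>j. bad j)"
    using Z_sets bad_sets by (intro measure_Un_le) auto
  finally have "prob (space M - good) \<le> \<delta>" using prob_Z prob_Bad by linarith
  then show ?thesis using prob_compl[OF good] by (simp add: good_def)
qed

end
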